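(* Let $X$ be a separable Banach space, $Y$ a Banach space, $G \subset X$ an open set, and $f: G \to Y$ a pointwise Lipschitz mapping. Then there exists a $\sigma$-directionally porous set $A \subset G$ such that for every $x \in G \setminus A$ the set $U_x$ of those directions $u \in X$ in which the one-sided directional derivative $f'_+(x,u)$ exists is a closed linear subspace of $X$. Moreover, for every $x \in G \setminus A$ the mapping $u \mapsto f'_+(x,u)$ is linear on $U_x$.
   Context: All Banach spaces are real. $B(x,r)$ denotes the open ball with center $x$ and radius $r$. The mapping $f: G \to Y$ is Lipschitz at $x \in G$ if $\limsup_{y \to x} \frac{\|f(y)-f(x)\|}{\|y-x\|} < \infty$; it is pointwise Lipschitz (on $G$) if it is Lipschitz at every point of $G$. Directional porosity: a set $A \subset X$ is directionally porous at a point $x \in X$ if there exist $0 \neq v \in X$, $p>0$ and a sequence $t_n \to 0$ of positive real numbers such that $B(x+t_n v, p t_n) \cap A = \emptyset$ for every $n$. The set $A$ is directionally porous if it is directionally porous at each point $x \in A$, and $\sigma$-directionally porous if it is a countable union of directionally porous sets. One-sided directional derivative of $f$ at $x \in G$ in the direction $v \in X$: $f'_+(x,v) := \lim_{t \to 0+} \frac{f(x+tv)-f(x)}{t}$ (limit in the norm of $Y$). *)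

theory Defs
  imports "HOL-Analysis.Analysis"
begin

(* A mapping f : G -> Y is represented by a total function, of which only the values on G
   matter: the limsup is taken within G, and pointwise_lipschitz_on and the directional
   derivatives are used only for open G and points x of G. The limsup is that of
   extended reals, so that finiteness is a genuine condition. *)

definition lipschitz_at ::
  "('a::real_normed_vector \<Rightarrow> 'b::real_normed_vector) \<Rightarrow> 'a set \<Rightarrow> 'a \<Rightarrow> bool" where
  "lipschitz_at f G x \<longleftrightarrow>
     Limsup (at x within G) (\<lambda>y. ereal (norm (f y - f x) / norm (y - x))) < \<infinity>"

definition pointwise_lipschitz_on ::
  "'a::real_normed_vector set \<Rightarrow> ('a \<Rightarrow> 'b::real_normed_vector) \<Rightarrow> bool" where
  "pointwise_lipschitz_on G f \<longleftrightarrow> (\<forall>x\<in>G. lipschitz_at f G x)"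

definition directionally_porous_at :: "'a::real_normed_vector set \<Rightarrow> 'a \<Rightarrow> bool" where
  "directionally_porous_at A x \<longleftrightarrow>
     (\<exists>v p. \<exists>t :: nat \<Rightarrow> real. v \<noteq> 0 \<and> p > 0 \<and> (\<forall>n. t n > 0) \<and> t \<longlonglongrightarrow> 0 \<and>
        (\<forall>n. ball (x + t n *\<^sub>R v) (p * t n) \<inter> A = {}))"

definition directionally_porous :: "'a::real_normed_vector set \<Rightarrow> bool" where
  "directionally_porous A \<longleftrightarrow> (\<forall>x\<in>A. directionally_porous_at A x)"

definition sigma_directionally_porous :: "'a::real_normed_vector set \<Rightarrow> bool" where
  "sigma_directionally_porous A \<longleftrightarrow>
     (\<exists>\<A>. countable \<A> \<and> (\<forall>B\<in>\<A>. directionally_porous B) \<and> A = \<Union>\<A>)"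

definition has_right_dir_deriv ::
  "('a::real_normed_vector \<Rightarrow> 'b::real_normed_vector) \<Rightarrow> 'a \<Rightarrow> 'a \<Rightarrow> 'b \<Rightarrow> bool" where
  "has_right_dir_deriv f x v l \<longleftrightarrow>
     ((\<lambda>t::real. (f (x + t *\<^sub>R v) - f x) /\<^sub>R t) \<longlongrightarrow> l) (at_right 0)"

(* Unspecified when the limit does not exist. *)
definition right_dir_deriv ::
  "('a::real_normed_vector \<Rightarrow> 'b::real_normed_vector) \<Rightarrow> 'a \<Rightarrow> 'a \<Rightarrow> 'b" where
  "right_dir_deriv f x v = Lim (at_right (0::real)) (\<lambda>t. (f (x + t *\<^sub>R v) - f x) /\<^sub>R t)"

definition right_diff_directions ::
  "('a::real_normed_vector \<Rightarrow> 'b::real_normed_vector) \<Rightarrow> 'a \<Rightarrow> 'a set" where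
  "right_diff_directions f x = {v. \<exists>l. has_right_dir_deriv f x v l}"

(* The library's linear is about maps defined on the whole type. *)
definition linear_on_subspace ::
  "'a::real_vector set \<Rightarrow> ('a \<Rightarrow> 'b::real_vector) \<Rightarrow> bool" where
  "linear_on_subspace U g \<longleftrightarrow>
     (\<forall>u\<in>U. \<forall>v\<in>U. g (u + v) = g u + g v) \<and> (\<forall>c. \<forall>u\<in>U. g (c *\<^sub>R u) = c *\<^sub>R g u)"

end

theory Submission
  imports Defs
begin

text \<open>
  Cover \<open>G\<close> by countably many sets on which \<open>f\<close> satisfies a quantitative Lipschitz estimate,
  and cut them further into the countably many sets where in addition \<open>f (y + t v) - f y\<close> is
  within \<open>e t\<close> of \<open>t b\<close> for all small \<open>t\<close>, with \<open>v\<close> and \<open>b\<close> from countable dense sets.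
  Discard from each set the points at which it is directionally porous. If \<open>x\<close> survives, then
  for every direction \<open>u\<close> and small \<open>t\<close> the point \<open>x + t u\<close> is within \<open>e t\<close> of a point \<open>y\<close> of
  the same set, so the increment of \<open>f\<close> along \<open>t v\<close> at \<open>x + t u\<close> agrees with the one at
  \<open>x\<close> up to \<open>o(t)\<close>. For \<open>u\<close> a direction of differentiability this is additivity,
  for \<open>u = - v\<close> it is oddness.
\<close>

section \<open>Sets with uniform Lipschitz and derivative bounds\<close>

text \<open>The clause \<open>y \<in> G\<close> keeps the ball of radius \<open>r\<close> inside
  \<open>G\<close>, so the values of the total function \<open>f\<close> outside \<open>G\<close>
  never enter.\<close>

definition lip_pts ::
  "('a::real_normed_vector \<Rightarrow> 'b::real_normed_vector) \<Rightarrow> 'a set \<Rightarrow> real \<Rightarrow> real \<Rightarrow> 'a set" where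
  "lip_pts f G K r =
     {x\<in>G. \<forall>y. dist y x < r \<longrightarrow> y \<in> G \<and> norm (f y - f x) \<le> K * dist y x}"

text \<open>The vector \<open>b\<close> is only a derivative in direction \<open>v\<close> up to the
  tolerance \<open>e\<close>. This slack is what lets \<open>v\<close> and \<open>b\<close> be taken
  from countable sets.\<close>

definition deriv_pts ::
  "('a::real_normed_vector \<Rightarrow> 'b::real_normed_vector) \<Rightarrow> 'a set \<Rightarrow> real \<Rightarrow> real \<Rightarrow>
     'a \<Rightarrow> 'b \<Rightarrow> real \<Rightarrow> 'a set" where
  "deriv_pts f G K r v b e =
     {x \<in> lip_pts f G K r. \<forall>t. 0 < t \<and> t < r \<longrightarrow> norm (f (x + t *\<^sub>R v) - f x - t *\<^sub>R b) \<le> e * t}"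

lemma lip_pts_mono: "x \<in> lip_pts f G K r \<Longrightarrow> s \<le> r \<Longrightarrow> x \<in> lip_pts f G K s"
  by (auto simp: lip_pts_def)

lemma lip_ptsD:
  "x \<in> lip_pts f G K r \<Longrightarrow> dist y x < r \<Longrightarrow> norm (f y - f x) \<le> K * dist y x"
  by (auto simp: lip_pts_def)

lemma directionally_porous_at_mono:
  "directionally_porous_at B x \<Longrightarrow> A \<subseteq> B \<Longrightarrow> directionally_porous_at A x"
  unfolding directionally_porous_at_def by blast

text \<open>A real bound above the limsup is valid on a small ball. Enlarging the bound and
  shrinking the radius makes both rational, so countably many sets \<open>lip_pts f G K r\<close>
  cover \<open>G\<close>.\<close>

lemma lipschitz_at_imp_lip_pts:
  assumes "open G" "x \<in> G" "lipschitz_at f G x"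
  obtains K r where "K \<in> \<rat>" "r \<in> \<rat>" "0 < K" "0 < r" "x \<in> lip_pts f G K r"
proof -
  let ?q = "\<lambda>y. ereal (norm (f y - f x) / norm (y - x))"
  obtain C where "Limsup (at x within G) ?q < ereal C"
    using assms(3) ereal_dense2 unfolding lipschitz_at_def by blast
  then have "\<forall>\<^sub>F y in at x within G. ?q y < ereal C"
    by (rule Limsup_lessD)
  then obtain d where d: "d > 0"
    "\<And>y. y \<in> G \<Longrightarrow> y \<noteq> x \<Longrightarrow> dist y x < d \<Longrightarrow> norm (f y - f x) / norm (y - x) < C"
    by (auto simp: eventually_at)
  obtain c where c: "c > 0" "\<And>y. dist y x < c \<Longrightarrow> y \<in> G"
    using assms(1,2) by (metis open_dist)
  obtain K where K: "K \<in> \<rat>" "max C 0 < K"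
    using Rats_dense_in_real[of "max C 0" "max C 0 + 1"] by auto
  obtain r where r: "r \<in> \<rat>" "0 < r" "r < min c d"
    using Rats_dense_in_real[of 0 "min c d"] c(1) d(1) by auto
  have "norm (f y - f x) \<le> K * dist y x" if "dist y x < r" for y
  proof (cases "y = x")
    case False
    have "norm (f y - f x) / norm (y - x) < C"
      using d(2)[of y] c(2)[of y] False that r by auto
    then have "norm (f y - f x) \<le> C * dist y x"
      using False by (simp add: divide_simps dist_norm)
    also have "\<dots> \<le> K * dist y x"
      using K by (intro mult_right_mono) auto
    finally show ?thesis .
  qed auto
  then have "x \<in> lip_pts f G K r"
    using c(2) r assms(2) by (auto simp: lip_pts_def)
  then show ?thesis
    using that K r by auto
qed

section \<open>Estimates at points where these sets are not porous\<close>

text \<open>Otherwise there are arbitrarily small \<open>t\<close> whose balls miss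
  \<open>S\<close>. Choosing \<open>t n\<close> below \<open>1 / real (Suc n)\<close> gives a null
  sequence that witnesses porosity in direction \<open>v\<close>.\<close>

lemma not_porous_at_imp_near:
  assumes "\<not> directionally_porous_at S x" "x \<in> S" "p > 0"
  shows "\<forall>\<^sub>F t in at_right 0. \<exists>y\<in>S. dist y (x + t *\<^sub>R v) < p * t"
proof (cases "v = 0")
  \<comment> \<open>Porosity only speaks of nonzero directions; here \<open>x\<close> itself is the
    nearby point.\<close>
  case True
  have "\<forall>\<^sub>F t in at_right (0::real). 0 < t"
    by (rule eventually_at_right_less)
  then show ?thesis
    by eventually_elim (use True assms in \<open>auto intro!: bexI[of _ x]\<close>)
next
  case False
  show ?thesis
  proof (rule ccontr)
    assume "\<not> ?thesis"
    then have "\<exists>t. 0 < t \<and> t < 1 / real (Suc n) \<and> ball (x + t *\<^sub>R v) (p * t) \<inter> S = {}" for n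
      unfolding eventually_at_right_field
      by (metis (no_types, lifting) disjoint_iff mem_ball dist_commute of_nat_0_less_iff
          zero_less_Suc zero_less_divide_1_iff)
    then obtain t where t: "\<And>n. 0 < t n" "\<And>n. t n < 1 / real (Suc n)"
      "\<And>n. ball (x + t n *\<^sub>R v) (p * t n) \<inter> S = {}"
      by metis
    have "t \<longlonglongrightarrow> 0"
      by (rule tendsto_sandwich[OF _ _ tendsto_const LIMSEQ_Suc[OF lim_1_over_n]])
         (use t in \<open>auto intro!: always_eventually less_imp_le simp del: of_nat_Suc\<close>)
    then show False
      using assms t False unfolding directionally_porous_at_def by blast
  qed
qed

lemma eventually_at_right_mult_less:
  fixes p r :: real
  assumes "r > 0"
  shows "\<forall>\<^sub>F t in at_right 0. p * t < r"
proof -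
  have "((\<lambda>t. p * t) \<longlongrightarrow> p * 0) (at_right 0)"
    by (intro tendsto_intros)
  then show ?thesis
    using assms by (auto dest: order_tendstoD(2))
qed

text \<open>
  Although \<open>f\<close> need not be Lipschitz near \<open>x\<close>, on the scale \<open>p t\<close> its oscillation at
  \<open>x + t w\<close> is controlled by passing through a point of \<open>lip_pts\<close>.
\<close>

lemma not_porous_at_lip_pts_estimate:
  assumes "\<not> directionally_porous_at (lip_pts f G K r) x" "x \<in> lip_pts f G K r"
    and "p > 0" "K > 0" "r > 0"
  shows "\<forall>\<^sub>F t in at_right 0. \<forall>z. dist z (x + t *\<^sub>R w) \<le> p * t \<longrightarrow>
           norm (f z - f (x + t *\<^sub>R w)) \<le> 3 * K * p * t"
proof -
  have "\<forall>\<^sub>F t in at_right 0. \<exists>y\<in>lip_pts f G K r. dist y (x + t *\<^sub>R w) < p * t"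
    using assms by (intro not_porous_at_imp_near) auto
  moreover have "\<forall>\<^sub>F t in at_right 0. 2 * p * t < r"
    by (rule eventually_at_right_mult_less) fact
  ultimately show ?thesis
  proof eventually_elim
    case (elim t)
    then obtain y where y: "y \<in> lip_pts f G K r" "dist y (x + t *\<^sub>R w) < p * t"
      by auto
    have pt: "0 < p * t"
      using y(2) by (meson le_less_trans zero_le_dist)
    show ?case
    proof (intro allI impI)
      fix z assume z: "dist z (x + t *\<^sub>R w) \<le> p * t"
      have zy: "dist z y < 2 * p * t"
        using z y(2) dist_triangle2[of z y "x + t *\<^sub>R w"] by simp
      have "norm (f z - f y) \<le> K * dist z y"
        using lip_ptsD[OF y(1)] zy elim(2) by simp
      also have "\<dots> \<le> K * (2 * p * t)"
        using zy assms(4) by (intro mult_left_mono) auto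
      finally have 1: "norm (f z - f y) \<le> K * (2 * p * t)" .
      have "norm (f (x + t *\<^sub>R w) - f y) \<le> K * dist (x + t *\<^sub>R w) y"
        using y(2) elim(2) pt by (intro lip_ptsD[OF y(1)]) (simp add: dist_commute)
      also have "\<dots> \<le> K * (p * t)"
        using y(2) assms(4) by (intro mult_left_mono) (auto simp: dist_commute)
      finally have 2: "norm (f (x + t *\<^sub>R w) - f y) \<le> K * (p * t)" .
      \<comment> \<open>The 3 is 2 + 1: \<open>z\<close> lies within \<open>2 * p * t\<close> of
        \<open>y\<close>, and \<open>x + t *\<^sub>R w\<close> within \<open>p * t\<close>.\<close>
      have "norm (f z - f (x + t *\<^sub>R w)) \<le> norm (f z - f y) + norm (f (x + t *\<^sub>R w) - f y)"
        using norm_triangle_ineq4[of "f z - f y" "f (x + t *\<^sub>R w) - f y"] by simp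
      then show "norm (f z - f (x + t *\<^sub>R w)) \<le> 3 * K * p * t"
        using 1 2 by (simp add: algebra_simps)
    qed
  qed
qed

text \<open>The increment is compared with the one from a nearby point \<open>y\<close> of the set
  in direction \<open>v0\<close>, which is known to be about \<open>t *\<^sub>R b0\<close>. Moving
  the base point to \<open>y\<close> costs \<open>K * e * t\<close>, moving the end point to
  \<open>y + t *\<^sub>R v0\<close> costs \<open>6 * K * e * t\<close>, and the tolerance and the
  passage from \<open>b0\<close> to \<open>b\<close> cost \<open>e * t\<close> each.\<close>

lemma not_porous_at_deriv_pts_estimate:
  fixes f :: "'a::real_normed_vector \<Rightarrow> 'b::real_normed_vector"
  assumes np: "\<not> directionally_porous_at (deriv_pts f G K r v0 b0 e) x"
    and x: "x \<in> deriv_pts f G K r v0 b0 e"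
    and pos: "K > 0" "r > 0" "e > 0"
    and v: "dist v v0 \<le> e" and b: "dist b b0 \<le> e"
  shows "\<forall>\<^sub>F t in at_right 0.
           norm (f (x + t *\<^sub>R (u + v)) - f (x + t *\<^sub>R u) - t *\<^sub>R b) \<le> (7 * K + 2) * e * t"
proof -
  have sub: "deriv_pts f G K r v0 b0 e \<subseteq> lip_pts f G K r"
    by (auto simp: deriv_pts_def)
  have npL: "\<not> directionally_porous_at (lip_pts f G K r) x"
    using np directionally_porous_at_mono[OF _ sub] by blast
  have "\<forall>\<^sub>F t in at_right 0. \<exists>y\<in>deriv_pts f G K r v0 b0 e. dist y (x + t *\<^sub>R u) < e * t"
    using np x pos(3) by (rule not_porous_at_imp_near)
  \<comment> \<open>The scale is \<open>2 * e\<close> because the end point is displaced twice by at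
    most \<open>e * t\<close>: once through \<open>y\<close>, once through
    \<open>v0\<close>.\<close>
  moreover have "\<forall>\<^sub>F t in at_right 0. \<forall>z. dist z (x + t *\<^sub>R (u + v)) \<le> (2 * e) * t \<longrightarrow>
           norm (f z - f (x + t *\<^sub>R (u + v))) \<le> 3 * K * (2 * e) * t"
    using x sub pos by (intro not_porous_at_lip_pts_estimate[OF npL]) auto
  moreover have "\<forall>\<^sub>F t in at_right 0. e * t < r"
    using pos(2) by (rule eventually_at_right_mult_less)
  moreover have "\<forall>\<^sub>F t in at_right 0. 1 * t < r"
    using pos(2) by (rule eventually_at_right_mult_less)
  moreover have "\<forall>\<^sub>F t in at_right (0::real). 0 < t"
    by (rule eventually_at_right_less)
  ultimately show ?thesis
  proof eventually_elim
    case (elim t)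
    then obtain y where y: "y \<in> deriv_pts f G K r v0 b0 e" "dist y (x + t *\<^sub>R u) < e * t"
      by auto
    have 1: "norm (f (y + t *\<^sub>R v0) - f y - t *\<^sub>R b0) \<le> e * t"
      using y(1) elim by (auto simp: deriv_pts_def)
    have "norm (f (x + t *\<^sub>R u) - f y) \<le> K * dist (x + t *\<^sub>R u) y"
      using y sub elim by (intro lip_ptsD[of y f G K r]) (auto simp: dist_commute)
    also have "\<dots> \<le> K * (e * t)"
      using y(2) pos by (intro mult_left_mono) (auto simp: dist_commute)
    finally have 2: "norm (f (x + t *\<^sub>R u) - f y) \<le> K * (e * t)" .
    have "dist (y + t *\<^sub>R v0) (x + t *\<^sub>R (u + v)) = norm ((y - (x + t *\<^sub>R u)) - t *\<^sub>R (v - v0))"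
      unfolding dist_norm by (rule arg_cong[where f = norm]) (simp add: algebra_simps)
    also have "\<dots> \<le> dist y (x + t *\<^sub>R u) + t * dist v v0"
      using norm_triangle_ineq4[of "y - (x + t *\<^sub>R u)" "t *\<^sub>R (v - v0)"] elim(5)
      by (simp add: dist_norm)
    also have "\<dots> \<le> e * t + t * e"
      using y(2) v elim by (intro add_mono mult_left_mono) auto
    finally have 3: "norm (f (y + t *\<^sub>R v0) - f (x + t *\<^sub>R (u + v))) \<le> 3 * K * (2 * e) * t"
      using elim by (simp add: algebra_simps)
    have 4: "norm (t *\<^sub>R b0 - t *\<^sub>R b) \<le> t * e"
      using b elim by (simp add: dist_norm norm_minus_commute flip: scaleR_diff_right)
    have "f (x + t *\<^sub>R (u + v)) - f (x + t *\<^sub>R u) - t *\<^sub>R b =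
        ((f (y + t *\<^sub>R v0) - f y - t *\<^sub>R b0) - (f (x + t *\<^sub>R u) - f y)) -
        ((f (y + t *\<^sub>R v0) - f (x + t *\<^sub>R (u + v))) - (t *\<^sub>R b0 - t *\<^sub>R b))"
      by simp
    also have "norm \<dots> \<le> (e * t + K * (e * t)) + (3 * K * (2 * e) * t + t * e)"
      by (rule order_trans[OF norm_triangle_ineq4 add_mono[OF
            order_trans[OF norm_triangle_ineq4 add_mono[OF 1 2]]
            order_trans[OF norm_triangle_ineq4 add_mono[OF 3 4]]]])
    finally show ?case
      by (simp add: algebra_simps)
  qed
qed

lemma has_right_dir_deriv_eventually:
  assumes "has_right_dir_deriv f x v b" "e > 0"
  shows "\<forall>\<^sub>F t in at_right 0. norm (f (x + t *\<^sub>R v) - f x - t *\<^sub>R b) \<le> e * t"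
proof -
  have "\<forall>\<^sub>F t in at_right 0. dist ((f (x + t *\<^sub>R v) - f x) /\<^sub>R t) b < e"
    using assms unfolding has_right_dir_deriv_def by (auto dest: tendstoD)
  moreover have "\<forall>\<^sub>F t in at_right (0::real). 0 < t"
    by (rule eventually_at_right_less)
  ultimately show ?thesis
  proof eventually_elim
    case (elim t)
    have "f (x + t *\<^sub>R v) - f x - t *\<^sub>R b = t *\<^sub>R ((f (x + t *\<^sub>R v) - f x) /\<^sub>R t - b)"
      using elim by (simp add: scaleR_diff_right)
    then show ?case
      using elim by (simp add: dist_norm mult.commute)
  qed
qed

text \<open>Three errors of \<open>e / 3 * t\<close> add up: changing the direction from
  \<open>v\<close> to \<open>v0\<close>, the definition of the derivative, and changing
  \<open>b\<close> to \<open>b0\<close>. The first is controlled because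
  \<open>lip_pts f G K r\<close> is not porous at \<open>x\<close>. A rational \<open>s\<close>
  keeps the resulting set in a countable family.\<close>

lemma mem_deriv_pts_of_deriv:
  assumes np: "\<not> directionally_porous_at (lip_pts f G K r) x" and x: "x \<in> lip_pts f G K r"
    and pos: "K > 0" "r > 0" "e > 0"
    and deriv: "has_right_dir_deriv f x v b"
    and v: "9 * K * dist v v0 < e" and b: "3 * dist b b0 < e"
  obtains s where "s \<in> \<rat>" "0 < s" "x \<in> deriv_pts f G K s v0 b0 e"
proof -
  \<comment> \<open>Chosen so that \<open>3 * K * p = e / 3\<close>.\<close>
  define p where "p = e / (9 * K)"
  have p: "p > 0" "dist v v0 \<le> p"
    using pos v by (auto simp: p_def field_simps)
  have "\<forall>\<^sub>F t in at_right 0. \<forall>z. dist z (x + t *\<^sub>R v) \<le> p * t \<longrightarrow>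
          norm (f z - f (x + t *\<^sub>R v)) \<le> 3 * K * p * t"
    using np x p(1) pos(1,2) by (rule not_porous_at_lip_pts_estimate)
  moreover have "\<forall>\<^sub>F t in at_right 0. norm (f (x + t *\<^sub>R v) - f x - t *\<^sub>R b) \<le> e / 3 * t"
    using deriv pos by (intro has_right_dir_deriv_eventually) auto
  moreover have "\<forall>\<^sub>F t in at_right (0::real). 0 < t"
    by (rule eventually_at_right_less)
  ultimately have "\<forall>\<^sub>F t in at_right 0. norm (f (x + t *\<^sub>R v0) - f x - t *\<^sub>R b0) \<le> e * t"
  proof eventually_elim
    case (elim t)
    have "dist (x + t *\<^sub>R v0) (x + t *\<^sub>R v) = t * dist v v0"
      using elim by (simp add: dist_norm norm_minus_commute flip: scaleR_diff_right)
    also have "\<dots> \<le> p * t"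
      using p elim by (simp add: mult.commute)
    finally have 1: "norm (f (x + t *\<^sub>R v0) - f (x + t *\<^sub>R v)) \<le> e / 3 * t"
      using elim pos by (simp add: p_def)
    have 2: "norm (t *\<^sub>R b0 - t *\<^sub>R b) \<le> e / 3 * t"
      using b elim by (simp add: dist_norm norm_minus_commute flip: scaleR_diff_right)
    have 3: "norm (f (x + t *\<^sub>R v) - f x - t *\<^sub>R b) \<le> e / 3 * t"
      using elim by simp
    have "f (x + t *\<^sub>R v0) - f x - t *\<^sub>R b0 =
        (f (x + t *\<^sub>R v0) - f (x + t *\<^sub>R v)) +
        ((f (x + t *\<^sub>R v) - f x - t *\<^sub>R b) - (t *\<^sub>R b0 - t *\<^sub>R b))"
      by simp
    also have "norm \<dots> \<le> e / 3 * t + (e / 3 * t + e / 3 * t)"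
      by (rule order_trans[OF norm_triangle_ineq
            add_mono[OF 1 order_trans[OF norm_triangle_ineq4 add_mono[OF 3 2]]]])
    finally show ?case
      by simp
  qed
  then obtain d where d: "d > 0"
    "\<And>t. 0 < t \<Longrightarrow> t < d \<Longrightarrow> norm (f (x + t *\<^sub>R v0) - f x - t *\<^sub>R b0) \<le> e * t"
    unfolding eventually_at_right_field by auto
  obtain s where s: "s \<in> \<rat>" "0 < s" "s < min d r"
    using Rats_dense_in_real[of 0 "min d r"] d(1) pos by auto
  then have "x \<in> deriv_pts f G K s v0 b0 e"
    using d(2) lip_pts_mono[OF x] by (auto simp: deriv_pts_def)
  then show ?thesis
    using that s by blast
qed

section \<open>Closedness and linear structure of the set of directions\<close>

text \<open>For \<open>v\<close> in the closure, the difference quotients along \<open>v\<close>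
  stay close, for all small \<open>t\<close>, to those along a nearby direction \<open>w\<close> of
  differentiability. They are therefore Cauchy as \<open>t\<close> tends to 0, and completeness of
  \<open>'b\<close> provides the limit.\<close>

lemma closed_right_diff_directions:
  fixes f :: "'a::real_normed_vector \<Rightarrow> 'b::banach"
  assumes np: "\<not> directionally_porous_at (lip_pts f G K r) x" and x: "x \<in> lip_pts f G K r"
    and pos: "K > 0" "r > 0"
  shows "closed (right_diff_directions f x)"
proof -
  let ?Q = "\<lambda>v t. (f (x + t *\<^sub>R v) - f x) /\<^sub>R t"
  have "v \<in> right_diff_directions f x" if v: "v \<in> closure (right_diff_directions f x)" for v
  proof -
    have "cauchy_filter (filtermap (?Q v) (at_right 0))"
      unfolding cauchy_filter_metric_filtermap
    proof (intro allI impI)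
      fix e :: real assume e: "e > 0"
      \<comment> \<open>Now \<open>3 * K * p = e / 4\<close>: replacing \<open>w\<close> by
        \<open>v\<close> and approximating \<open>l\<close> along \<open>w\<close> cost
        \<open>e / 4\<close> each, so any two quotients along \<open>v\<close> differ by less than
        \<open>e\<close>.\<close>
      define p where "p = e / (12 * K)"
      have p: "p > 0"
        using e pos by (simp add: p_def)
      obtain w l where w: "dist w v < p" "has_right_dir_deriv f x w l"
        using v p unfolding closure_approachable right_diff_directions_def by blast
      have "\<forall>\<^sub>F t in at_right 0. \<forall>z. dist z (x + t *\<^sub>R v) \<le> p * t \<longrightarrow>
              norm (f z - f (x + t *\<^sub>R v)) \<le> 3 * K * p * t"
        using np x p pos by (rule not_porous_at_lip_pts_estimate)
      moreover have "\<forall>\<^sub>F t in at_right 0. dist (?Q w t) l < e / 4"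
        using w(2) e unfolding has_right_dir_deriv_def by (intro tendstoD) auto
      moreover have "\<forall>\<^sub>F t in at_right (0::real). 0 < t"
        by (rule eventually_at_right_less)
      ultimately have "\<forall>\<^sub>F t in at_right 0. dist (?Q v t) l < e / 2"
      proof eventually_elim
        case (elim t)
        have "dist (x + t *\<^sub>R w) (x + t *\<^sub>R v) \<le> p * t"
          using w(1) elim by (simp add: dist_norm mult.commute flip: scaleR_diff_right)
        then have "norm (f (x + t *\<^sub>R w) - f (x + t *\<^sub>R v)) \<le> e / 4 * t"
          using elim pos by (simp add: p_def)
        moreover have "dist (?Q w t) (?Q v t) = norm (f (x + t *\<^sub>R w) - f (x + t *\<^sub>R v)) / t"
        proof -
          have "?Q w t - ?Q v t = (f (x + t *\<^sub>R w) - f (x + t *\<^sub>R v)) /\<^sub>R t"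
            by (simp add: scaleR_diff_right)
          then show ?thesis
            using elim(3) by (simp only: dist_norm norm_scaleR) (simp add: divide_inverse_commute)
        qed
        ultimately have "dist (?Q w t) (?Q v t) \<le> e / 4"
          using elim by (simp add: pos_divide_le_eq)
        then show ?case
          using elim dist_triangle3[of "?Q v t" l "?Q w t"] by simp
      qed
      then show "\<exists>P. eventually P (at_right 0) \<and>
          (\<forall>s t. P s \<and> P t \<longrightarrow> dist (?Q v s) (?Q v t) < e)"
        by (intro exI[of _ "\<lambda>t. dist (?Q v t) l < e / 2"]) (auto intro: dist_triangle_half_l)
    qed
    moreover have "filtermap (?Q v) (at_right 0) \<noteq> bot"
      by (simp add: filtermap_bot_iff)
    ultimately obtain l where "filtermap (?Q v) (at_right 0) \<le> nhds l"
      using complete_UNIV[where 'a='b] unfolding complete_uniform by auto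
    then show ?thesis
      unfolding right_diff_directions_def has_right_dir_deriv_def filterlim_def by auto
  qed
  then show ?thesis
    by (metis closure_subset closure_closed subsetI subset_antisym closed_closure)
qed

lemma has_right_dir_deriv_scaleR_pos:
  assumes "has_right_dir_deriv f x v l" "c > 0"
  shows "has_right_dir_deriv f x (c *\<^sub>R v) (c *\<^sub>R l)"
proof -
  have "filterlim (\<lambda>t. t * c) (at_right 0) (at_right (0::real))"
    using assms(2) filterlim_times_pos[of "\<lambda>t. t" 0 "at_right 0" c 0]
    by (simp add: filterlim_ident mult.commute)
  then have "((\<lambda>t. (f (x + (t * c) *\<^sub>R v) - f x) /\<^sub>R (t * c)) \<longlongrightarrow> l) (at_right 0)"
    using assms(1) unfolding has_right_dir_deriv_def by (rule filterlim_compose[rotated])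
  then have "((\<lambda>t. c *\<^sub>R ((f (x + (t * c) *\<^sub>R v) - f x) /\<^sub>R (t * c))) \<longlongrightarrow> c *\<^sub>R l) (at_right 0)"
    by (intro tendsto_intros)
  then show ?thesis
    using assms(2) unfolding has_right_dir_deriv_def by (simp add: field_simps)
qed

lemma right_dir_deriv_eq: "has_right_dir_deriv f x v l \<Longrightarrow> right_dir_deriv f x v = l"
  unfolding has_right_dir_deriv_def right_dir_deriv_def by (intro tendsto_Lim) auto

text \<open>The quotient along \<open>u + v\<close> is the quotient along \<open>u\<close> plus the
  shifted quotient of the hypothesis, whence additivity. Positive homogeneity comes from rescaling
  \<open>t\<close>, and oddness extends it to negative scalars.\<close>

lemma subspace_linear_of_shift:
  fixes f :: "'a::real_normed_vector \<Rightarrow> 'b::real_normed_vector"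
  assumes shift: "\<And>u v b. has_right_dir_deriv f x v b \<Longrightarrow>
    ((\<lambda>t. (f (x + t *\<^sub>R (u + v)) - f (x + t *\<^sub>R u)) /\<^sub>R t) \<longlongrightarrow> b) (at_right 0)"
  shows "subspace (right_diff_directions f x)"
    and "linear_on_subspace (right_diff_directions f x) (right_dir_deriv f x)"
proof -
  have zero: "has_right_dir_deriv f x 0 0"
    unfolding has_right_dir_deriv_def by simp
  have add: "has_right_dir_deriv f x (u + v) (a + b)"
    if "has_right_dir_deriv f x u a" "has_right_dir_deriv f x v b" for u v a b
    using tendsto_add[OF that(1)[unfolded has_right_dir_deriv_def] shift[OF that(2), of u]]
    unfolding has_right_dir_deriv_def by (simp flip: scaleR_add_right)
  \<comment> \<open>With \<open>u = - v\<close> the end point \<open>x + t *\<^sub>R (u + v)\<close>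
    is \<open>x\<close>, so the shifted quotient is minus the quotient along
    \<open>- v\<close>.\<close>
  have neg: "has_right_dir_deriv f x (- v) (- b)" if "has_right_dir_deriv f x v b" for v b
    using tendsto_minus[OF shift[OF that, of "- v"]]
    unfolding has_right_dir_deriv_def by (simp flip: scaleR_minus_right)
  have scale: "has_right_dir_deriv f x (c *\<^sub>R v) (c *\<^sub>R b)"
    if "has_right_dir_deriv f x v b" for c v b
  proof (cases c "0::real" rule: linorder_cases)
    case less
    then show ?thesis
      using neg[OF has_right_dir_deriv_scaleR_pos[OF that, of "- c"]] by simp
  qed (use zero has_right_dir_deriv_scaleR_pos that in auto)
  show "subspace (right_diff_directions f x)"
    unfolding subspace_def right_diff_directions_def using zero add scale by blast
  show "linear_on_subspace (right_diff_directions f x) (right_dir_deriv f x)"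
    unfolding linear_on_subspace_def right_diff_directions_def
    using add scale right_dir_deriv_eq by (smt (verit) mem_Collect_eq)
qed

section \<open>A countable supply of approximate derivatives\<close>

text \<open>The type \<open>'b\<close> carries no separability assumption, so candidate derivatives
  are built from values of \<open>f\<close>. A derivative is a limit of quotients with step
  \<open>1 / real (Suc n)\<close>, that is, of natural multiples of differences of values, and
  continuity moves both points into \<open>D\<close>.\<close>

lemma has_right_dir_deriv_dense:
  fixes f :: "'a::real_normed_vector \<Rightarrow> 'b::real_normed_vector"
  assumes D: "closure D = UNIV" and "open G" "continuous_on G f" "x \<in> G"
    and deriv: "has_right_dir_deriv f x v b" and "e > 0"
  obtains n :: nat and y z where "y \<in> D" "z \<in> D" "dist b (real n *\<^sub>R (f y - f z)) < e"
proof -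
  have inv: "filterlim (\<lambda>n. 1 / real (Suc n)) (at_right 0) sequentially"
    unfolding filterlim_at using LIMSEQ_Suc[OF lim_1_over_n] by (auto simp del: of_nat_Suc)
  have "(\<lambda>n. (f (x + (1 / real (Suc n)) *\<^sub>R v) - f x) /\<^sub>R (1 / real (Suc n))) \<longlonglongrightarrow> b"
    using deriv inv unfolding has_right_dir_deriv_def by (rule filterlim_compose)
  then have "\<forall>\<^sub>F n in sequentially.
      dist ((f (x + (1 / real (Suc n)) *\<^sub>R v) - f x) /\<^sub>R (1 / real (Suc n))) b < e / 2"
    using assms(6) by (intro tendstoD) auto
  moreover have "\<forall>\<^sub>F n in sequentially. x + (1 / real (Suc n)) *\<^sub>R v \<in> G"
  proof -
    have "(\<lambda>n. x + (1 / real (Suc n)) *\<^sub>R v) \<longlonglongrightarrow> x + 0 *\<^sub>R v"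
      by (intro tendsto_intros LIMSEQ_Suc[OF lim_1_over_n])
    then show ?thesis
      using assms(2,4) by (auto dest: topological_tendstoD)
  qed
  ultimately obtain n where
    n: "dist ((f (x + (1 / real (Suc n)) *\<^sub>R v) - f x) /\<^sub>R (1 / real (Suc n))) b < e / 2"
      "x + (1 / real (Suc n)) *\<^sub>R v \<in> G"
    using eventually_happens[OF eventually_conj] by (metis (lifting) sequentially_bot)
  define N where "N = real (Suc n)"
  define w where "w = x + (1 / N) *\<^sub>R v"
  \<comment> \<open>Multiplication by \<open>N\<close> magnifies errors, so both values of
    \<open>f\<close> are approximated to within \<open>e / (4 * N)\<close>; together they contribute
    at most \<open>e / 2\<close>.\<close>
  have N: "N > 0"
    by (simp add: N_def)
  have approx: "\<exists>y\<in>D. norm (f y - f c) < e / (4 * N)" if "c \<in> G" for c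
  proof -
    have "isCont f c"
      using assms(2,3) that continuous_on_eq_continuous_at by blast
    then obtain d where d: "d > 0" "\<And>y. dist y c < d \<Longrightarrow> dist (f y) (f c) < e / (4 * N)"
      using N assms(6) unfolding continuous_at_eps_delta by (metis divide_pos_pos mult_pos_pos zero_less_numeral)
    have "c \<in> closure D"
      using D by simp
    then obtain y where "y \<in> D" "dist y c < d"
      using d(1) unfolding closure_approachable by blast
    then show ?thesis
      using d(2) by (auto simp: dist_norm)
  qed
  obtain y where y: "y \<in> D" "norm (f y - f w) < e / (4 * N)"
    using approx[of w] n(2) by (auto simp: w_def N_def)
  obtain z where z: "z \<in> D" "norm (f z - f x) < e / (4 * N)"
    using approx[OF assms(4)] by auto
  have "norm ((f y - f w) - (f z - f x)) \<le> e / (4 * N) + e / (4 * N)"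
    using y(2) z(2) by (intro order_trans[OF norm_triangle_ineq4]) simp
  then have "N * norm ((f y - f w) - (f z - f x)) \<le> N * (e / (4 * N) + e / (4 * N))"
    using N by (intro mult_left_mono) auto
  moreover have "N *\<^sub>R (f y - f z) - N *\<^sub>R (f w - f x) = N *\<^sub>R ((f y - f w) - (f z - f x))"
    by (simp add: algebra_simps)
  moreover have "N * (e / (4 * N) + e / (4 * N)) = e / 2"
    using N by (simp add: field_simps)
  ultimately have "dist (N *\<^sub>R (f y - f z)) (N *\<^sub>R (f w - f x)) \<le> e / 2"
    using N by (simp only: dist_norm norm_scaleR abs_of_pos)
  moreover have "dist (N *\<^sub>R (f w - f x)) b < e / 2"
    using n(1) by (simp add: w_def N_def)
  ultimately have "dist b (N *\<^sub>R (f y - f z)) < e"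
    using dist_triangle[of "N *\<^sub>R (f y - f z)" b "N *\<^sub>R (f w - f x)"]
    by (simp add: dist_commute)
  then show ?thesis
    using that[of y z "Suc n"] y z by (simp add: N_def)
qed

lemma pointwise_lipschitz_on_continuous_on:
  assumes "open G" "pointwise_lipschitz_on G f"
  shows "continuous_on G f"
proof (rule continuous_at_imp_continuous_on, rule ballI)
  fix x assume "x \<in> G"
  then obtain K r where Kr: "0 < K" "0 < r" "x \<in> lip_pts f G K r"
    using lipschitz_at_imp_lip_pts assms unfolding pointwise_lipschitz_on_def by metis
  show "isCont f x"
    unfolding continuous_at_eps_delta
  proof (intro allI impI)
    fix e :: real assume e: "e > 0"
    have "dist (f y) (f x) < e" if "dist y x < min r (e / K)" for y
    proof -
      have "dist (f y) (f x) \<le> K * dist y x"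
        using lip_ptsD[OF Kr(3)] that by (simp add: dist_norm)
      also have "\<dots> < e"
        using that Kr by (simp add: pos_less_divide_eq mult.commute)
      finally show ?thesis .
    qed
    then show "\<exists>d>0. \<forall>y. dist y x < d \<longrightarrow> dist (f y) (f x) < e"
      using e Kr by (intro exI[of _ "min r (e / K)"]) auto
  qed
qed

section \<open>The exceptional set and the conclusion\<close>

text \<open>Porosity at a point passes to subsets, so the points of \<open>F\<close> at which
  \<open>F\<close> is porous form a directionally porous set.\<close>

lemma sigma_directionally_porous_UN_porous_points:
  assumes "countable \<F>"
  shows "sigma_directionally_porous (\<Union>F\<in>\<F>. {x\<in>F. directionally_porous_at F x})"
  unfolding sigma_directionally_porous_def directionally_porous_def
  using assms
  by (intro exI[of _ "(\<lambda>F. {x\<in>F. directionally_porous_at F x}) ` \<F>"])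
     (auto elim: directionally_porous_at_mono)

theorem corollary3p5:
  fixes G :: "'a::banach set" and f :: "'a \<Rightarrow> 'b::banach"
  assumes "separable_space (euclidean :: 'a topology)"
    and "open G"
    and "pointwise_lipschitz_on G f"
  shows "\<exists>A. A \<subseteq> G \<and> sigma_directionally_porous A \<and>
    (\<forall>x \<in> G - A.
       subspace (right_diff_directions f x) \<and>
       closed (right_diff_directions f x) \<and>
       linear_on_subspace (right_diff_directions f x) (right_dir_deriv f x))"
proof -
  obtain D :: "'a set" where D: "countable D" "closure D = UNIV"
    using assms(1) unfolding separable_space_def by (auto simp: euclidean_closure_of)
  \<comment> \<open>The set \<open>C\<close> stands in for a countable dense set in
    \<open>'b\<close>: it approximates every one-sided derivative of \<open>f\<close> at points of
    \<open>G\<close>.\<close>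
  define C where "C = (\<lambda>(n, y, z). real n *\<^sub>R (f y - f z)) ` (UNIV \<times> D \<times> D)"
  define \<F> where "\<F> = (\<lambda>(K, r). lip_pts f G K r) ` (\<rat> \<times> \<rat>) \<union>
    (\<lambda>(K, r, v, b, e). deriv_pts f G K r v b e) ` (\<rat> \<times> \<rat> \<times> D \<times> C \<times> \<rat>)"
  define A where "A = (\<Union>F\<in>\<F>. {x\<in>F. directionally_porous_at F x})"
  have "countable C"
    unfolding C_def using D by (intro countable_image countable_SIGMA) auto
  then have "countable \<F>"
    unfolding \<F>_def using D
    by (intro countable_Un countable_image countable_SIGMA countable_rat)
  then have "sigma_directionally_porous A"
    unfolding A_def by (rule sigma_directionally_porous_UN_porous_points)
  moreover have "A \<subseteq> G"
    by (auto simp: A_def \<F>_def lip_pts_def deriv_pts_def)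
  moreover have "subspace (right_diff_directions f x) \<and>
       closed (right_diff_directions f x) \<and>
       linear_on_subspace (right_diff_directions f x) (right_dir_deriv f x)" if x: "x \<in> G - A" for x
  proof -
    obtain K r where Kr: "K \<in> \<rat>" "r \<in> \<rat>" "0 < K" "0 < r" and xL: "x \<in> lip_pts f G K r"
      using lipschitz_at_imp_lip_pts assms(2,3) x unfolding pointwise_lipschitz_on_def by blast
    have "lip_pts f G K r \<in> \<F>"
      using Kr unfolding \<F>_def by force
    then have npL: "\<not> directionally_porous_at (lip_pts f G K r) x"
      using x xL unfolding A_def by blast
    \<comment> \<open>The key claim: to first order, the increment of \<open>f\<close> along
      \<open>t *\<^sub>R v\<close> is the same from \<open>x + t *\<^sub>R u\<close> as from
      \<open>x\<close>.\<close>
    have "((\<lambda>t. (f (x + t *\<^sub>R (u + v)) - f (x + t *\<^sub>R u)) /\<^sub>R t) \<longlongrightarrow> b) (at_right 0)"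
      if deriv: "has_right_dir_deriv f x v b" for u v b
    proof (rule tendstoI)
      fix \<epsilon> :: real assume "\<epsilon> > 0"
      \<comment> \<open>The Lipschitz constant \<open>K\<close> is fixed before \<open>e\<close>, so
        the final error \<open>(7 * K + 2) * e\<close> can be brought below \<epsilon>.\<close>
      then obtain e where e: "e \<in> \<rat>" "0 < e" "e < \<epsilon> / (7 * K + 2)"
        using Rats_dense_in_real[of 0 "\<epsilon> / (7 * K + 2)"] Kr by auto
      have "v \<in> closure D"
        using D by simp
      moreover have "min e (e / (9 * K)) > 0"
        using e Kr by simp
      \<comment> \<open>The bound \<open>e / (9 * K)\<close> puts \<open>x\<close> into the set
        \<open>deriv_pts\<close>; the bound \<open>e\<close> serves the estimate for the shifted
        increment.\<close>
      ultimately obtain v0 where v0: "v0 \<in> D" "dist v0 v < min e (e / (9 * K))"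
        unfolding closure_approachable by blast
      have xG: "x \<in> G" and e3: "0 < e / 3"
        using x e by auto
      obtain n :: nat and y z
        where "y \<in> D" "z \<in> D" "dist b (real n *\<^sub>R (f y - f z)) < e / 3"
        by (rule has_right_dir_deriv_dense[OF D(2) assms(2)
              pointwise_lipschitz_on_continuous_on[OF assms(2,3)] xG deriv e3])
      then obtain b0 where b0: "b0 \<in> C" "dist b b0 < e / 3"
        unfolding C_def by force
      have vv: "9 * K * dist v v0 < e"
        using v0(2) Kr by (simp add: dist_commute field_simps)
      have bb: "3 * dist b b0 < e"
        using b0(2) by simp
      obtain s where s: "s \<in> \<rat>" "0 < s" and xE: "x \<in> deriv_pts f G K s v0 b0 e"
        using mem_deriv_pts_of_deriv[OF npL xL Kr(3,4) e(2) deriv vv bb] by blast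
      \<comment> \<open>Non-porosity is used a second time: once \<open>x\<close> is known to lie in
        this member of \<open>\<F>\<close>, being outside \<open>A\<close> excludes porosity of that
        set at \<open>x\<close>.\<close>
      have "deriv_pts f G K s v0 b0 e \<in> \<F>"
        unfolding \<F>_def using Kr(1) s(1) v0(1) b0(1) e(1) by force
      then have npE: "\<not> directionally_porous_at (deriv_pts f G K s v0 b0 e) x"
        using x xE unfolding A_def by blast
      have "dist v v0 \<le> e" "dist b b0 \<le> e"
        using v0(2) b0(2) e(2) by (auto simp: dist_commute)
      note not_porous_at_deriv_pts_estimate[OF npE xE Kr(3) s(2) e(2) this, of u]
      moreover have "\<forall>\<^sub>F t in at_right (0::real). 0 < t"
        by (rule eventually_at_right_less)
      ultimately show "\<forall>\<^sub>F t in at_right 0.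
          dist ((f (x + t *\<^sub>R (u + v)) - f (x + t *\<^sub>R u)) /\<^sub>R t) b < \<epsilon>"
      proof eventually_elim
        case (elim t)
        let ?d = "f (x + t *\<^sub>R (u + v)) - f (x + t *\<^sub>R u)"
        have "?d /\<^sub>R t - b = (?d - t *\<^sub>R b) /\<^sub>R t"
          using elim by (simp add: scaleR_diff_right)
        then have "dist (?d /\<^sub>R t) b = norm (?d - t *\<^sub>R b) / t"
          using elim by (simp add: dist_norm divide_inverse_commute)
        also have "\<dots> \<le> (7 * K + 2) * e"
          using elim by (simp add: pos_divide_le_eq)
        also have "\<dots> < \<epsilon>"
          using e(3) Kr by (simp add: pos_less_divide_eq mult.commute)
        finally show ?case .
      qed
    qed
    then show ?thesis
      using subspace_linear_of_shift closed_right_diff_directions[OF npL xL Kr(3,4)] by blast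
  qed
  ultimately show ?thesis
    by blast
qed

end
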